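(* Let $\alpha>0$, let $u_0$ be a probability density on $[0,\infty)$, let $\Lambda$ be a physical solution to the supercooled Stefan problem with initial density $u_0$, and let $u$ be the associated density. Let $(x_0,t_0)\in\mathbb{R}\times(0,\infty)$, and let $r\in(0,t_0/10)$ with $r^2<t_0$. There exists a constant $c>0$ such that $$u(x,t)\ge c\,(x-\Lambda_t)^+,\qquad (x,t)\in Q_r(x_0,t_0),$$ where $Q_r(x_0,t_0)=(x_0-r,x_0+r)\times(t_0-r^2,t_0+r^2)$.
   Context: Let $\alpha>0$, and let $u_0\ge 0$ be a probability density on $[0,\infty)$. Let $B$ be a standard Brownian motion on $\mathbb{R}$ whose initial value $B_0$ has distribution $u_0(x)\,dx$. A nondecreasing, right-continuous function $\Lambda:[0,\infty)\to[0,\infty)$ is a probabilistic solution to the supercooled Stefan problem if, with $\tau=\inf\{t\ge 0: B_t\le \Lambda_t\}$, one has $\Lambda_t=\alpha\,\mathbb{P}(\tau\le t)$ for all $t\ge 0$. Write $\Lambda_{t-}=\lim_{r\uparrow t}\Lambda_r$ for $t>0$ and $\Lambda_{0-}=0$. A probabilistic solution $\Lambda$ is a physical solution if, for every $t\ge 0$, $$\Lambda_t-\Lambda_{t-}=\inf\{x>0:\ \mathbb{P}(t\le\tau,\ B_t\in(\Lambda_{t-},\Lambda_{t-}+x])<\alpha^{-1}x\}.$$ The density $u:\mathbb{R}\times(0,\infty)\to\mathbb{R}$ is given by $\mathbb{P}(B_t\in[a,b],\,t<\tau)=\int_a^b u(x,t)\,dx$ for $a<b$, $t>0$, taken with the representative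 that is smooth in $\{(x,t):t>0,\ x>\Lambda_t\}$ and vanishes for $x\le\Lambda_t$. $y^+=\max(y,0)$.
   Formalization: The formal statement adds the assumption Λ_0 < α (not all mass freezes at time 0); without it the claim fails, e.g. for u_0 = 1/α on [0,α], where Λ ≡ α and u ≡ 0. *)

theory Defs
  imports "HOL-Probability.Probability"
begin

text \<open>Probability densities on \<open>[0,\<infinity>)\<close> are extended by zero to the whole line.\<close>

definition probability_density_on_half_line :: "(real \<Rightarrow> real) \<Rightarrow> bool" where
  "probability_density_on_half_line u0 \<longleftrightarrow>
     u0 \<in> borel_measurable borel \<and> (\<forall>x. 0 \<le> u0 x) \<and> (\<forall>x<0. u0 x = 0) \<and>
     (\<integral>\<^sup>+x. ennreal (u0 x) \<partial>lborel) = 1"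

text \<open>
  Standard Brownian motion with an arbitrary initial law. The independence clause says that, for
  all times \<open>0 = t 0 \<le> t 1 \<le> \<dots> \<le> t n\<close>, the initial value and the successive increments are
  independent; in particular \<open>B 0\<close> is independent of all increments. All paths are required to be
  continuous, so that the events defined through hitting times below are measurable even when
  \<open>M\<close> is not complete. Only \<open>B t\<close> with \<open>t \<ge> 0\<close> is constrained.
\<close>

definition brownian_motion :: "'a measure \<Rightarrow> (real \<Rightarrow> 'a \<Rightarrow> real) \<Rightarrow> bool" where
  "brownian_motion M B \<longleftrightarrow>
     prob_space M \<and>
     (\<forall>t\<ge>0. B t \<in> borel_measurable M) \<and>
     (\<forall>\<omega>\<in>space M. continuous_on {0..} (\<lambda>t. B t \<omega>)) \<and>
     (\<forall>s t. 0 \<le> s \<longrightarrow> s < t \<longrightarrow>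
        distributed M lborel (\<lambda>\<omega>. B t \<omega> - B s \<omega>) (\<lambda>x. ennreal (normal_density 0 (sqrt (t - s)) x))) \<and>
     (\<forall>(n::nat) (t::nat \<Rightarrow> real). t 0 = 0 \<longrightarrow> mono t \<longrightarrow>
        prob_space.indep_vars M (\<lambda>_. borel)
          (\<lambda>i \<omega>. case i of 0 \<Rightarrow> B 0 \<omega> | Suc k \<Rightarrow> B (t (Suc k)) \<omega> - B (t k) \<omega>) {..n})"

text \<open>
  The infimum is taken in the extended reals, so that the hitting time is \<open>\<infinity>\<close> on paths that
  never hit the barrier.
\<close>

definition hitting_time :: "(real \<Rightarrow> 'a \<Rightarrow> real) \<Rightarrow> (real \<Rightarrow> real) \<Rightarrow> 'a \<Rightarrow> ereal" where
  "hitting_time B \<Lambda> \<omega> = (INF t\<in>{t. 0 \<le> t \<and> B t \<omega> \<le> \<Lambda> t}. ereal t)"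

definition probabilistic_solution ::
  "'a measure \<Rightarrow> (real \<Rightarrow> 'a \<Rightarrow> real) \<Rightarrow> real \<Rightarrow> (real \<Rightarrow> real) \<Rightarrow> bool" where
  "probabilistic_solution M B \<alpha> \<Lambda> \<longleftrightarrow>
     mono_on {0..} \<Lambda> \<and> (\<forall>t\<ge>0. 0 \<le> \<Lambda> t) \<and> (\<forall>t\<ge>0. continuous (at_right t) \<Lambda>) \<and>
     (\<forall>t\<ge>0. \<Lambda> t = \<alpha> * measure M {\<omega> \<in> space M. hitting_time B \<Lambda> \<omega> \<le> ereal t})"

definition left_limit :: "(real \<Rightarrow> real) \<Rightarrow> real \<Rightarrow> real" where
  "left_limit \<Lambda> t = (if t > 0 then Lim (at_left t) \<Lambda> else 0)"

text \<open>
  The set in the jump condition contains every \<open>x > \<alpha>\<close>, so its real infimum is meaningful.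
  The condition at time \<open>0\<close> does not exclude total freezing: for instance if \<open>B 0\<close> is uniformly
  distributed on \<open>[0, \<alpha>]\<close>, the constant \<open>\<Lambda> = \<alpha>\<close> is a physical solution.
\<close>

definition physical_solution ::
  "'a measure \<Rightarrow> (real \<Rightarrow> 'a \<Rightarrow> real) \<Rightarrow> real \<Rightarrow> (real \<Rightarrow> real) \<Rightarrow> bool" where
  "physical_solution M B \<alpha> \<Lambda> \<longleftrightarrow>
     probabilistic_solution M B \<alpha> \<Lambda> \<and>
     (\<forall>t\<ge>0. \<Lambda> t - left_limit \<Lambda> t =
        Inf {x. 0 < x \<and>
               measure M {\<omega> \<in> space M. ereal t \<le> hitting_time B \<Lambda> \<omega> \<and>
                            B t \<omega> \<in> {left_limit \<Lambda> t <.. left_limit \<Lambda> t + x}}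
               < inverse \<alpha> * x})"

text \<open>\<open>C\<^sup>k\<close> and \<open>C\<^sup>\<infinity>\<close> regularity; intended for open sets \<open>S\<close>.\<close>

primrec Ck_on ::
  "nat \<Rightarrow> ('a::real_normed_vector \<Rightarrow> 'b::real_normed_vector) \<Rightarrow> 'a set \<Rightarrow> bool" where
  "Ck_on 0 f S \<longleftrightarrow> continuous_on S f"
| "Ck_on (Suc k) f S \<longleftrightarrow>
     (\<forall>x\<in>S. f differentiable (at x)) \<and> (\<forall>v. Ck_on k (\<lambda>x. frechet_derivative f (at x) v) S)"

definition smooth_on ::
  "('a::real_normed_vector \<Rightarrow> 'b::real_normed_vector) \<Rightarrow> 'a set \<Rightarrow> bool" where
  "smooth_on f S \<longleftrightarrow> (\<forall>k. Ck_on k f S)"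

text \<open>
  The sub-probability density of the process killed at the hitting time. Smoothness on the open
  region above the barrier and vanishing elsewhere determine \<open>u x t\<close> for every \<open>x\<close> and \<open>t > 0\<close>;
  values at \<open>t \<le> 0\<close> are irrelevant.
\<close>

definition associated_density ::
  "'a measure \<Rightarrow> (real \<Rightarrow> 'a \<Rightarrow> real) \<Rightarrow> (real \<Rightarrow> real) \<Rightarrow> (real \<Rightarrow> real \<Rightarrow> real) \<Rightarrow> bool" where
  "associated_density M B \<Lambda> u \<longleftrightarrow>
     (\<forall>t>0. \<forall>a b. a < b \<longrightarrow>
        set_integrable lborel {a..b} (\<lambda>x. u x t) \<and>
        measure M {\<omega> \<in> space M. B t \<omega> \<in> {a..b} \<and> ereal t < hitting_time B \<Lambda> \<omega>}
          = (LINT x:{a..b}|lborel. u x t)) \<and>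
     smooth_on (\<lambda>(x, t). u x t) {(x, t). 0 < t \<and> \<Lambda> t < x} \<and>
     (\<forall>t>0. \<forall>x\<le>\<Lambda> t. u x t = 0)"

definition parabolic_cylinder :: "real \<Rightarrow> real \<Rightarrow> real \<Rightarrow> (real \<times> real) set" where
  "parabolic_cylinder r x0 t0 = {x0 - r <..< x0 + r} \<times> {t0 - r\<^sup>2 <..< t0 + r\<^sup>2}"

end

theory Submission
  imports Defs
begin

text \<open>
  Since \<open>\<Lambda>\<close> is nondecreasing, on \<open>[\<epsilon>, t]\<close> the process survives at least as long as it stays above
  the constant level \<open>\<Lambda> t\<close>. By the reflection principle the transition density of Brownian motion
  killed at a constant level \<open>L\<close> is \<open>\<phi>(x - y) - \<phi>(x + y - 2L)\<close>, which is at least a constant times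
  \<open>(x - L) (y - L)\<close>. It therefore suffices that, for a small \<open>\<epsilon>\<close> preceding the cylinder, the
  surviving process has with positive probability reached a bounded interval above \<open>\<alpha> + 1\<close> at time
  \<open>\<epsilon>\<close>; as \<open>\<Lambda> \<le> \<alpha>\<close>, this interval is at distance at least \<open>1\<close> from the barrier at all later times.
  Because \<open>\<Lambda> 0 < \<alpha>\<close>, the initial value exceeds \<open>\<Lambda> 0\<close> with positive probability, and right-continuity
  of \<open>\<Lambda>\<close> at \<open>0\<close> reduces that claim to a constant barrier as well.

  The reflection estimate is proved for the process observed on dyadic grids, where only finitely
  many independent increments occur, and passed to the limit by continuity of paths.
\<close>

subsection \<open>Gaussian kernels\<close>

text \<open>The transition probability of Brownian motion into \<open>[a, b]\<close> over time
  \<open>T\<close>, seen as a function of the starting point \<open>y\<close>.\<close>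

definition gauss_interval :: "real \<Rightarrow> real \<Rightarrow> real \<Rightarrow> real \<Rightarrow> real" where
  "gauss_interval T a b y = (LINT x:{a..b}|lborel. normal_density y (sqrt T) x)"

lemma set_integrable_normal_density:
  assumes "0 < \<sigma>"
  shows "set_integrable lborel {a..b} (normal_density \<mu> \<sigma>)"
  unfolding set_integrable_def using assms
  by (intro integrable_mult_indicator integrable_normal_density) auto

lemma gauss_interval_nonneg: "0 \<le> gauss_interval T a b y"
  unfolding gauss_interval_def set_lebesgue_integral_def
  by (intro integral_nonneg_AE) (auto simp: indicator_def)

lemma measurable_gauss_interval [measurable]: "gauss_interval T a b \<in> borel_measurable borel"
  unfolding gauss_interval_def[abs_def] set_lebesgue_integral_def normal_density_def by measurable

lemma emeasure_centered_normal_shift: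
  assumes "0 < T"
  shows "emeasure (density lborel (\<lambda>x. ennreal (normal_density 0 (sqrt T) x))) {z. y + z \<in> {a..b}}
    = ennreal (gauss_interval T a b y)"
proof -
  have "emeasure (density lborel (\<lambda>x. ennreal (normal_density 0 (sqrt T) x))) {z. y + z \<in> {a..b}}
      = (\<integral>\<^sup>+z. ennreal (normal_density 0 (sqrt T) z) * indicator {z. y + z \<in> {a..b}} z \<partial>lborel)"
    by (subst emeasure_density) auto
  also have "\<dots> = (\<integral>\<^sup>+z. ennreal (indicator {a..b} (y + 1 * z) *\<^sub>R normal_density y (sqrt T) (y + 1 * z)) \<partial>lborel)"
    by (intro nn_integral_cong) (auto simp: indicator_def normal_density_def)
  also have "\<dots> = (\<integral>\<^sup>+x. ennreal (indicator {a..b} x *\<^sub>R normal_density y (sqrt T) x) \<partial>lborel)"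
    by (subst nn_integral_real_affine[where c=1 and t=y]) (auto)
  also have "\<dots> = ennreal (gauss_interval T a b y)"
    unfolding gauss_interval_def set_lebesgue_integral_def
    using set_integrable_normal_density[of "sqrt T" a b y] assms
    by (intro nn_integral_eq_integral) (auto simp: set_integrable_def)
  finally show ?thesis .
qed

text \<open>The Gaussian kernel depends only on the distance of its arguments, so the substitution
  of \<open>2 * L - x\<close> for \<open>x\<close> moves the reflection from the target interval to
  the starting point.\<close>

lemma gauss_interval_reflect: "gauss_interval T (2 * L - b) (2 * L - a) y = gauss_interval T a b (2 * L - y)"
proof -
  have "gauss_interval T (2 * L - b) (2 * L - a) y
    = (LINT x|lborel. indicator {2 * L - b..2 * L - a} (2 * L + (-1) * x) *\<^sub>R
        normal_density y (sqrt T) (2 * L + (-1) * x))"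
    unfolding gauss_interval_def set_lebesgue_integral_def
    by (subst lborel_integral_real_affine[where c="-1" and t="2 * L"]) auto
  also have "\<dots> = gauss_interval T a b (2 * L - y)"
    unfolding gauss_interval_def set_lebesgue_integral_def
    by (intro Bochner_Integration.integral_cong)
       (auto simp: indicator_def normal_density_def power2_eq_square algebra_simps)
  finally show ?thesis .
qed

text \<open>Reflecting a start below \<open>L\<close> brings it closer to every point of a target
  above \<open>L\<close>. This is what makes the discarded paths in the grid argument
  harmless.\<close>

lemma gauss_interval_reflect_le:
  assumes "0 < T" "y \<le> L" "L \<le> a"
  shows "gauss_interval T a b y \<le> gauss_interval T a b (2 * L - y)"
  unfolding gauss_interval_def
proof (rule set_integral_mono)
  fix x assume "x \<in> {a..b}"
  then have "0 \<le> (x - L) * (L - y)" using assms by auto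
  then have "(x - (2 * L - y))\<^sup>2 \<le> (x - y)\<^sup>2"
    by (simp add: power2_eq_square algebra_simps)
  then show "normal_density y (sqrt T) x \<le> normal_density (2 * L - y) (sqrt T) x"
    using assms by (auto simp: normal_density_def field_simps)
qed (use assms in \<open>auto intro: set_integrable_normal_density\<close>)

text \<open>
  The first factor bounds the Gaussian kernel from below; the second one comes from
  \<open>1 - exp (- z) \<ge> z / (1 + z)\<close> with \<open>z = 2 * (x - L) * (y - L) / T\<close>.
\<close>

definition kernel_const :: "real \<Rightarrow> real \<Rightarrow> real \<Rightarrow> real" where
  "kernel_const D T1 T2 = exp (- (D\<^sup>2 / (2 * T1))) / sqrt (2 * pi * T2) * (2 / (T2 + 2 * D\<^sup>2))"

lemma kernel_const_pos: "0 < T2 \<Longrightarrow> 0 < kernel_const D T1 T2"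
  by (auto simp: kernel_const_def intro!: mult_pos_pos divide_pos_pos add_pos_nonneg)

lemma killed_kernel_lower_bound:
  assumes T: "0 < T1" "T1 \<le> T" "T \<le> T2"
    and x: "L \<le> x" "x \<le> L + D" and y: "L \<le> y" "y \<le> L + D"
  shows "kernel_const D T1 T2 * ((x - L) * (y - L))
    \<le> normal_density y (sqrt T) x - normal_density (2 * L - y) (sqrt T) x"
proof -
  define p where "p = (x - L) * (y - L)"
  define z where "z = 2 * p / T"
  have T0: "0 < T" using T by simp
  have p: "0 \<le> p" "p \<le> D\<^sup>2"
    using x y by (auto simp: p_def power2_eq_square intro!: mult_mono)
  have z: "0 \<le> z" using p T0 by (simp add: z_def)
  \<comment> \<open>Reflection adds exactly \<open>4 * p\<close> to the squared distance, so the
    mirrored Gaussian is the direct one times \<open>exp (- z)\<close>.\<close>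
  have "(x - (2 * L - y))\<^sup>2 = (x - y)\<^sup>2 + 4 * p"
    by (simp add: p_def power2_eq_square algebra_simps)
  then have "- (x - (2 * L - y))\<^sup>2 / (2 * T) = - (x - y)\<^sup>2 / (2 * T) + - z"
    using T0 by (simp add: z_def field_simps)
  then have ex: "exp (- (x - (2 * L - y))\<^sup>2 / (2 * T)) = exp (- (x - y)\<^sup>2 / (2 * T)) * exp (- z)"
    by (simp only: exp_add)
  have nd: "normal_density w (sqrt T) x = exp (- (x - w)\<^sup>2 / (2 * T)) / sqrt (2 * pi * T)" for w
    using T0 by (simp add: normal_density_def)
  have eq: "normal_density y (sqrt T) x - normal_density (2 * L - y) (sqrt T) x
      = exp (- (x - y)\<^sup>2 / (2 * T)) / sqrt (2 * pi * T) * (1 - exp (- z))"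
    unfolding nd ex by (simp only: right_diff_distrib mult_1_right times_divide_eq_left)
  have "\<bar>x - y\<bar> \<le> D" using x y by auto
  then have "(x - y)\<^sup>2 \<le> D\<^sup>2"
    by (metis abs_ge_zero power2_abs power_mono)
  then have "(x - y)\<^sup>2 / (2 * T) \<le> D\<^sup>2 / (2 * T1)"
    using T by (intro frac_le) auto
  then have a: "exp (- (D\<^sup>2 / (2 * T1))) / sqrt (2 * pi * T2)
      \<le> exp (- (x - y)\<^sup>2 / (2 * T)) / sqrt (2 * pi * T)"
    using T T0 by (intro frac_le) auto
  have "1 + z \<le> exp z" by (rule exp_ge_add_one_self)
  then have "1 - 1 / (1 + z) \<le> 1 - exp (- z)"
    using z by (simp add: exp_minus field_simps)
  moreover have "1 - 1 / (1 + z) = 2 * p / (T + 2 * p)"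
    using p T0 by (simp add: z_def field_simps)
  \<comment> \<open>Only the denominator is replaced by its worst case; the numerator keeps
    \<open>p\<close>, which carries the linear decay at the barrier.\<close>
  moreover have "2 / (T2 + 2 * D\<^sup>2) * p \<le> 2 * p / (T + 2 * p)"
    using p T T0 by (auto intro!: frac_le)
  ultimately have b: "2 / (T2 + 2 * D\<^sup>2) * p \<le> 1 - exp (- z)" by simp
  have "kernel_const D T1 T2 * p
      = exp (- (D\<^sup>2 / (2 * T1))) / sqrt (2 * pi * T2) * (2 / (T2 + 2 * D\<^sup>2) * p)"
    by (simp add: kernel_const_def)
  also have "\<dots> \<le> exp (- (x - y)\<^sup>2 / (2 * T)) / sqrt (2 * pi * T) * (1 - exp (- z))"
    using a b p T T0 by (intro mult_mono) auto
  finally show ?thesis by (simp add: eq p_def)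
qed

text \<open>The pointwise kernel bound is integrated with \<open>x - L\<close> frozen at its
  smallest value \<open>a - L\<close>. In the end \<open>b\<close> tends to \<open>a\<close>, so
  nothing is lost.\<close>

lemma gauss_interval_reflect_diff_ge:
  assumes T: "0 < T1" "T1 \<le> T" "T \<le> T2" and ab: "L \<le> a" "a \<le> b" "b \<le> L + D"
    and y: "L \<le> y" "y \<le> L + D"
  shows "kernel_const D T1 T2 * ((a - L) * (y - L)) * (b - a)
    \<le> gauss_interval T a b y - gauss_interval T a b (2 * L - y)"
proof -
  have K: "0 < kernel_const D T1 T2" using T by (intro kernel_const_pos) auto
  note int = set_integrable_normal_density[of "sqrt T" a b]
  have "kernel_const D T1 T2 * ((a - L) * (y - L)) * (b - a)
    = (LINT x:{a..b}|lborel. kernel_const D T1 T2 * ((a - L) * (y - L)))"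
    using ab by (simp add: set_lebesgue_integral_def)
  also have "\<dots> \<le> (LINT x:{a..b}|lborel. normal_density y (sqrt T) x - normal_density (2 * L - y) (sqrt T) x)"
  proof (rule set_integral_mono)
    fix x assume x: "x \<in> {a..b}"
    have "kernel_const D T1 T2 * ((a - L) * (y - L)) \<le> kernel_const D T1 T2 * ((x - L) * (y - L))"
      using K x y by (intro mult_left_mono mult_right_mono) auto
    also have "\<dots> \<le> normal_density y (sqrt T) x - normal_density (2 * L - y) (sqrt T) x"
      using assms x by (intro killed_kernel_lower_bound) auto
    finally show "kernel_const D T1 T2 * ((a - L) * (y - L))
      \<le> normal_density y (sqrt T) x - normal_density (2 * L - y) (sqrt T) x" .
  next
    show "set_integrable lborel {a..b} (\<lambda>x. kernel_const D T1 T2 * ((a - L) * (y - L)))"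
      by (intro borel_integrable_atLeastAtMost') (rule continuous_on_const)
    show "set_integrable lborel {a..b} (\<lambda>x. normal_density y (sqrt T) x - normal_density (2 * L - y) (sqrt T) x)"
      using T by (intro set_integral_diff int) auto
  qed
  also have "\<dots> = gauss_interval T a b y - gauss_interval T a b (2 * L - y)"
    unfolding gauss_interval_def using T by (intro set_integral_diff int) auto
  finally show ?thesis .
qed

subsection \<open>Paths and moving barriers\<close>

lemma right_continuous_less:
  fixes \<Lambda> :: "real \<Rightarrow> real"
  assumes "continuous (at_right t) \<Lambda>" "\<Lambda> t < c"
  obtains b where "t < b" "\<And>y. t \<le> y \<Longrightarrow> y < b \<Longrightarrow> \<Lambda> y < c"
proof -
  have "(\<Lambda> \<longlongrightarrow> \<Lambda> t) (at_right t)" using assms(1) by (simp add: continuous_within)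
  then have "eventually (\<lambda>y. \<Lambda> y < c) (at_right t)" using assms(2) by (rule order_tendstoD)
  then obtain b where "t < b" "\<forall>y>t. y < b \<longrightarrow> \<Lambda> y < c"
    by (auto simp: eventually_at_right_field)
  then show ?thesis using assms(2) that by (metis le_less)
qed

lemma continuous_on_less_right:
  fixes p :: "real \<Rightarrow> real"
  assumes "continuous_on {0..} p" "0 \<le> v" "p v < c"
  obtains b where "v < b" "\<And>y. v \<le> y \<Longrightarrow> y < b \<Longrightarrow> p y < c"
proof -
  have "continuous (at v within {v..}) p"
    using assms(1,2) by (metis atLeast_iff atLeast_subset_iff continuous_on_eq_continuous_within
        continuous_on_subset order_refl)
  then have "continuous (at_right v) p"
    by (rule continuous_within_subset) auto
  then show ?thesis using right_continuous_less assms(3) that by blast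
qed

text \<open>An infimum strictly above \<open>t\<close> needs more than no hit up to
  \<open>t\<close>: a whole interval after \<open>t\<close> must be free of hits, and
  right-continuity of path and barrier provides it.\<close>

lemma hitting_time_gt_iff:
  assumes "0 \<le> t" "continuous_on {0..} (\<lambda>t. B t \<omega>)" "continuous (at_right t) \<Lambda>"
  shows "ereal t < hitting_time B \<Lambda> \<omega> \<longleftrightarrow> (\<forall>v\<in>{0..t}. \<Lambda> v < B v \<omega>)"
proof
  assume *: "ereal t < hitting_time B \<Lambda> \<omega>"
  show "\<forall>v\<in>{0..t}. \<Lambda> v < B v \<omega>"
  proof (intro ballI, rule ccontr)
    fix v assume v: "v \<in> {0..t}" and "\<not> \<Lambda> v < B v \<omega>"
    then have "hitting_time B \<Lambda> \<omega> \<le> ereal v"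
      unfolding hitting_time_def by (intro INF_lower) auto
    then have "ereal t < ereal v" using * by (rule less_le_trans[rotated])
    then show False using v by simp
  qed
next
  assume *: "\<forall>v\<in>{0..t}. \<Lambda> v < B v \<omega>"
  \<comment> \<open>The midpoint separates barrier and path for a while after \<open>t\<close>; the
    bound on the path is obtained from its negative.\<close>
  define c where "c = (\<Lambda> t + B t \<omega>) / 2"
  have c: "\<Lambda> t < c" "- B t \<omega> < - c" using *[rule_format, of t] assms(1) by (auto simp: c_def)
  obtain b1 where b1: "t < b1" "\<And>y. t \<le> y \<Longrightarrow> y < b1 \<Longrightarrow> \<Lambda> y < c"
    using right_continuous_less[OF assms(3) c(1)] by blast
  have "continuous_on {0..} (\<lambda>t. - B t \<omega>)" using assms(2) by (rule continuous_on_minus)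
  then obtain b2 where b2: "t < b2" "\<And>y. t \<le> y \<Longrightarrow> y < b2 \<Longrightarrow> - B y \<omega> < - c"
    using continuous_on_less_right[where p="\<lambda>t. - B t \<omega>", OF _ assms(1) c(2)] by blast
  have "ereal (min b1 b2) \<le> hitting_time B \<Lambda> \<omega>"
    unfolding hitting_time_def
  proof (rule INF_greatest)
    fix v assume v: "v \<in> {t. 0 \<le> t \<and> B t \<omega> \<le> \<Lambda> t}"
    have "\<not> v < min b1 b2"
    proof
      assume "v < min b1 b2"
      then have "\<Lambda> v < B v \<omega>"
        using *[rule_format, of v] b1(2)[of v] b2(2)[of v] v by (cases "v \<le> t") auto
      then show False using v by auto
    qed
    then show "ereal (min b1 b2) \<le> ereal v" by (simp only: ereal_less_eq not_less)
  qed
  moreover have "ereal t < ereal (min b1 b2)" using b1 b2 by simp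
  ultimately show "ereal t < hitting_time B \<Lambda> \<omega>" by (rule less_le_trans[rotated])
qed

text \<open>The reason is that \<open>p - \<Lambda>\<close> is lower semicontinuous.\<close>

lemma uniform_gap_above_barrier:
  fixes \<Lambda> p :: "real \<Rightarrow> real"
  assumes "mono_on {0..} \<Lambda>" "\<And>v. 0 \<le> v \<Longrightarrow> continuous (at_right v) \<Lambda>"
    and "continuous_on {0..} p" "\<And>v. v \<in> {0..t} \<Longrightarrow> \<Lambda> v < p v"
  shows "\<exists>k::nat. \<forall>v\<in>{0..t}. \<Lambda> v + inverse (real (Suc k)) \<le> p v"
proof (rule ccontr)
  assume "\<not> ?thesis"
  then have "\<forall>k::nat. \<exists>v\<in>{0..t}. p v < \<Lambda> v + inverse (real (Suc k))"
    by (meson not_le)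
  then obtain w where w: "\<And>k::nat. w k \<in> {0..t}" "\<And>k. p (w k) < \<Lambda> (w k) + inverse (real (Suc k))"
    by metis
  have "compact {0..t}" by simp
  then obtain v r where v: "v \<in> {0..t}" and r: "strict_mono (r :: nat \<Rightarrow> nat)" "(w \<circ> r) \<longlonglongrightarrow> v"
    using w(1) unfolding compact_eq_seq_compact_metric seq_compact_def by meson
  \<comment> \<open>One third of the gap for each of three errors: the rise of the barrier, the drop
    of the path, and the vanishing term \<open>inverse (real (Suc (r k)))\<close>.\<close>
  define d where "d = (p v - \<Lambda> v) / 3"
  have d: "0 < d" using assms(4)[OF v] by (simp add: d_def)
  obtain b where b: "v < b" "\<And>y. v \<le> y \<Longrightarrow> y < b \<Longrightarrow> \<Lambda> y < \<Lambda> v + d"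
    using right_continuous_less[of v \<Lambda> "\<Lambda> v + d"] assms(2)[of v] v d by auto
  have "eventually (\<lambda>k. (w \<circ> r) k < b) sequentially"
    using r(2) b(1) by (rule order_tendstoD)
  moreover have "(\<lambda>k. p ((w \<circ> r) k)) \<longlonglongrightarrow> p v"
    using v w(1) by (intro continuous_on_tendsto_compose[OF assms(3) r(2)]) auto
  then have "eventually (\<lambda>k. p v - d < p ((w \<circ> r) k)) sequentially"
    using d by (intro order_tendstoD) auto
  moreover have "(\<lambda>k. inverse (real (Suc (r k)))) \<longlonglongrightarrow> 0"
    using LIMSEQ_subseq_LIMSEQ[OF LIMSEQ_inverse_real_of_nat r(1)] by (simp add: o_def)
  then have "eventually (\<lambda>k. inverse (real (Suc (r k))) < d) sequentially"
    using d by (intro order_tendstoD) auto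
  ultimately have "eventually (\<lambda>k. (w \<circ> r) k < b \<and> p v - d < p ((w \<circ> r) k)
      \<and> inverse (real (Suc (r k))) < d) sequentially"
    by eventually_elim auto
  then obtain k where k: "w (r k) < b" "p v - d < p (w (r k))" "inverse (real (Suc (r k))) < d"
    by (auto simp: eventually_sequentially)
  \<comment> \<open>On the right of \<open>v\<close> this is right-continuity; on the left, where
    the barrier may jump, monotonicity suffices.\<close>
  have "\<Lambda> (w (r k)) < \<Lambda> v + d"
  proof (cases "v \<le> w (r k)")
    case True
    then show ?thesis using b(2) k(1) by simp
  next
    case False
    then have "\<Lambda> (w (r k)) \<le> \<Lambda> v"
      using w(1)[of "r k"] v by (intro mono_onD[OF assms(1)]) auto
    then show ?thesis using d by simp
  qed
  then have "p v - d < \<Lambda> v + d + d"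
    using w(2)[of "r k"] k by linarith
  then show False by (simp add: d_def field_simps)
qed

text \<open>A violation at \<open>v < t\<close> persists for a while to the right, because the path
  is continuous and the barrier does not decrease, and hence occurs at a rational time. The endpoint
  \<open>t\<close> has no room to its right and is listed separately.\<close>

lemma barrier_gap_from_rationals:
  fixes \<Lambda> p :: "real \<Rightarrow> real"
  assumes "mono_on {0..} \<Lambda>" "continuous_on {0..} p"
    and q: "\<And>q. q \<in> (\<rat> \<inter> {0..t}) \<union> {t} \<Longrightarrow> \<Lambda> q + c \<le> p q" and v: "v \<in> {0..t}"
  shows "\<Lambda> v + c \<le> p v"
proof (rule ccontr)
  assume less: "\<not> \<Lambda> v + c \<le> p v"
  then have "v < t" using v q[of t] by (cases "v = t") auto
  obtain b where b: "v < b" "\<And>y. v \<le> y \<Longrightarrow> y < b \<Longrightarrow> p y < \<Lambda> v + c"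
    using continuous_on_less_right[OF assms(2), of v "\<Lambda> v + c"] less v by auto
  obtain y where y: "y \<in> \<rat>" "v < y" "y < min b t"
    using Rats_dense_in_real[of v "min b t"] b \<open>v < t\<close> by auto
  have "\<Lambda> v \<le> \<Lambda> y" using y v by (intro mono_onD[OF assms(1)]) auto
  then show False using q[of y] b(2)[of y] y v by auto
qed

lemma dyadic_between:
  fixes x y :: real
  assumes "0 \<le> x" "x < y"
  obtains N j :: nat where "x < real j / 2 ^ N" "real j / 2 ^ N < y"
proof -
  obtain N where N: "(1 / 2) ^ N < y - x"
    using real_arch_pow_inv[of "y - x" "1 / 2"] assms by auto
  define j where "j = nat \<lfloor>x * 2 ^ N\<rfloor> + 1"
  have "0 \<le> x * 2 ^ N" using assms by simp
  then have j: "x * 2 ^ N < real j" "real j \<le> x * 2 ^ N + 1"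
    unfolding j_def by linarith+
  have "real j / 2 ^ N \<le> x + (1 / 2) ^ N"
    using j(2) by (simp add: field_simps)
  moreover have "x < real j / 2 ^ N" using j(1) by (simp add: field_simps)
  ultimately show ?thesis using that[of j N] N by linarith
qed

subsection \<open>Brownian motion above a barrier\<close>

locale brownian =
  fixes M :: "'a measure" and B :: "real \<Rightarrow> 'a \<Rightarrow> real"
  assumes bm: "brownian_motion M B"
begin

sublocale prob_space M
  using bm by (simp add: brownian_motion_def)

lemma measurable_B: "0 \<le> t \<Longrightarrow> B t \<in> borel_measurable M"
  using bm by (simp add: brownian_motion_def)

lemma continuous_path: "\<omega> \<in> space M \<Longrightarrow> continuous_on {0..} (\<lambda>t. B t \<omega>)"
  using bm by (simp add: brownian_motion_def)

lemma distr_increment: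
  assumes "0 \<le> s" "s < t"
  shows "distr M borel (\<lambda>\<omega>. B t \<omega> - B s \<omega>)
    = density lborel (\<lambda>x. ennreal (normal_density 0 (sqrt (t - s)) x))"
proof -
  have "distributed M lborel (\<lambda>\<omega>. B t \<omega> - B s \<omega>) (\<lambda>x. ennreal (normal_density 0 (sqrt (t - s)) x))"
    using bm assms by (simp add: brownian_motion_def)
  then have "distr M lborel (\<lambda>\<omega>. B t \<omega> - B s \<omega>)
    = density lborel (\<lambda>x. ennreal (normal_density 0 (sqrt (t - s)) x))"
    by (simp add: distributed_def)
  moreover have "distr M lborel (\<lambda>\<omega>. B t \<omega> - B s \<omega>) = distr M borel (\<lambda>\<omega>. B t \<omega> - B s \<omega>)"
    by (intro distr_cong) auto
  ultimately show ?thesis by simp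
qed

lemma indep_increments:
  assumes "t 0 = (0::real)" "mono (t :: nat \<Rightarrow> real)"
  shows "indep_vars (\<lambda>_. borel)
    (\<lambda>i \<omega>. case i of 0 \<Rightarrow> B 0 \<omega> | Suc k \<Rightarrow> B (t (Suc k)) \<omega> - B (t k) \<omega>) {..n}"
  using bm assms by (simp add: brownian_motion_def)

section \<open>Finite time grids and the Markov property\<close>

definition grid_event :: "(nat \<Rightarrow> real) \<Rightarrow> (nat \<Rightarrow> real set) \<Rightarrow> nat \<Rightarrow> 'a set" where
  "grid_event t S k = {\<omega> \<in> space M. \<forall>j\<le>k. B (t j) \<omega> \<in> S j}"

lemma grid_event_sets:
  assumes "t 0 = 0" "mono t" "\<And>j. j \<le> k \<Longrightarrow> S j \<in> sets borel"
  shows "grid_event t S k \<in> events"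
proof -
  have "0 \<le> t j" for j using monoD[OF assms(2), of 0 j] assms(1) by simp
  then have "B (t j) -` S j \<inter> space M \<in> events" if "j \<le> k" for j
    using measurable_B assms(3)[OF that] by (meson measurable_sets)
  then have "(\<Inter>j\<in>{..k}. B (t j) -` S j \<inter> space M) \<in> events"
    by (intro sets.finite_INT) auto
  also have "(\<Inter>j\<in>{..k}. B (t j) -` S j \<inter> space M) = grid_event t S k"
    by (auto simp: grid_event_def)
  finally show ?thesis .
qed

text \<open>The grid event is determined by the initial value and the increments up to
  \<open>t k\<close>, which are independent of \<open>B T - B (t k)\<close>. Integrating out this
  last increment leaves a Gaussian centred at \<open>B (t k)\<close>.\<close>

lemma grid_markov:
  assumes t: "t 0 = 0" "mono t" and tk: "t k < T"
    and S: "\<And>j. j \<le> k \<Longrightarrow> S j \<in> sets borel"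
  shows "prob (grid_event t S k \<inter> {\<omega> \<in> space M. B T \<omega> \<in> {a..b}})
    = (LINT \<omega>|M. indicator (grid_event t S k) \<omega> * gauss_interval (T - t k) a b (B (t k) \<omega>))"
proof -
  \<comment> \<open>All times after index \<open>k\<close> are set to \<open>T\<close>, so that
    increment number \<open>Suc k\<close> is \<open>B T - B (t k)\<close> and the sequence stays
    monotone.\<close>
  define t' where "t' j = (if j \<le> k then t j else T)" for j
  define D where "D i \<omega> = (case i of 0 \<Rightarrow> B 0 \<omega> | Suc k \<Rightarrow> B (t' (Suc k)) \<omega> - B (t' k) \<omega>)" for i \<omega>
  have t0: "0 \<le> t j" for j using monoD[OF t(2), of 0 j] t(1) by simp
  have "t j \<le> T" if "j \<le> k" for j
    using monoD[OF t(2) that] tk by simp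
  then have "mono t'"
    using monoD[OF t(2)] unfolding t'_def by (intro monoI) auto
  moreover have "t' 0 = 0" by (simp add: t'_def t)
  ultimately have ind: "indep_vars (\<lambda>_. borel) D {..Suc k}"
    using indep_increments[of t' "Suc k"] by (simp add: D_def[abs_def])
  \<comment> \<open>Telescoping recovers each position from the independent family, whose entry
    \<open>0\<close> is \<open>B 0\<close>.\<close>
  have sumD: "(\<Sum>i\<le>j. D i \<omega>) = B (t' j) \<omega>" for j \<omega>
    by (induction j) (auto simp: D_def \<open>t' 0 = 0\<close>)
  define P where "P = PiM {..k} (\<lambda>_. borel :: real measure)"
  define Y where "Y \<omega> = restrict (\<lambda>i. D i \<omega>) {..k}" for \<omega>
  define Z where "Z \<omega> = B T \<omega> - B (t k) \<omega>" for \<omega>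
  \<comment> \<open>Independence of disjoint blocks of indices concerns restricted families, so the
    single increment is carried as a point of a product over the one index
    \<open>Suc k\<close>.\<close>
  define Q where "Q = PiM {Suc k} (\<lambda>_. borel :: real measure)"
  define Z' where "Z' \<omega> = restrict (\<lambda>i. D i \<omega>) {Suc k}" for \<omega>
  have Z'_eval: "Z' \<omega> (Suc k) = Z \<omega>" for \<omega>
    by (simp add: Z'_def D_def t'_def Z_def)
  have Z: "Z \<in> borel_measurable M"
    unfolding Z_def[abs_def] using measurable_B t0[of k] tk by (intro borel_measurable_diff) auto
  have "indep_var P Y Q Z'"
    unfolding P_def Q_def Y_def Z'_def by (rule indep_var_restrict[OF ind]) auto
  then have Y: "Y \<in> measurable M P" and Z': "Z' \<in> measurable M Q"
    and joint: "distr M P Y \<Otimes>\<^sub>M distr M Q Z' = distr M (P \<Otimes>\<^sub>M Q) (\<lambda>x. (Y x, Z' x))"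
    by (auto simp: indep_var_distribution_eq)
  have sumY: "(\<Sum>i\<le>j. Y \<omega> i) = B (t j) \<omega>" if "j \<le> k" for j \<omega>
    using that sumD by (simp add: Y_def t'_def)
  define V where "V = {y \<in> space P. \<forall>j\<in>{..k}. (\<Sum>i\<le>j. y i) \<in> S j}"
  have V: "V \<in> sets P"
  proof -
    have "(\<lambda>y. \<Sum>i\<le>j. y i) \<in> borel_measurable P" if "j \<le> k" for j
      unfolding P_def using that by (intro borel_measurable_sum) auto
    then have "(\<lambda>y. \<Sum>i\<le>j. y i) -` S j \<inter> space P \<in> sets P" if "j \<le> k" for j
      using that S[OF that] by (meson measurable_sets)
    moreover have "(\<lambda>y. \<Sum>i\<le>j. y i) -` S j \<inter> space P = {y \<in> space P. (\<Sum>i\<le>j. y i) \<in> S j}" for j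
      by auto
    ultimately have "{y \<in> space P. (\<Sum>i\<le>j. y i) \<in> S j} \<in> sets P" if "j \<le> k" for j
      using that by simp
    then show ?thesis unfolding V_def by (intro sets.sets_Collect_finite_All) auto
  qed
  have [measurable]: "(\<lambda>z. z (Suc k)) \<in> borel_measurable Q"
    unfolding Q_def by measurable
  define W where "W = {yz \<in> space (P \<Otimes>\<^sub>M Q). fst yz \<in> V \<and> (\<Sum>i\<le>k. fst yz i) + snd yz (Suc k) \<in> {a..b}}"
  have W: "W \<in> sets (P \<Otimes>\<^sub>M Q)"
  proof -
    have [measurable]: "(\<lambda>y. \<Sum>i\<le>k. y i) \<in> borel_measurable P"
      unfolding P_def by (intro borel_measurable_sum) auto
    note V[measurable]
    have [measurable]: "(\<lambda>yz. \<Sum>i\<le>k. fst yz i) \<in> borel_measurable (P \<Otimes>\<^sub>M Q)"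
      by (rule measurable_compose[OF measurable_fst]) measurable
    have [measurable]: "(\<lambda>yz. snd yz (Suc k)) \<in> borel_measurable (P \<Otimes>\<^sub>M Q)"
      by (rule measurable_compose[OF measurable_snd]) measurable
    show ?thesis unfolding W_def by measurable
  qed
  have YV: "indicator V (Y \<omega>) = (indicator (grid_event t S k) \<omega> :: ennreal)" if "\<omega> \<in> space M" for \<omega>
    using that measurable_space[OF Y that] by (auto simp: indicator_def V_def grid_event_def sumY)
  interpret Zs: prob_space "distr M Q Z'" by (rule prob_space_distr) fact
  have ev: "grid_event t S k \<inter> {\<omega> \<in> space M. B T \<omega> \<in> {a..b}} = (\<lambda>x. (Y x, Z' x)) -` W \<inter> space M"
    using measurable_space[OF Y] measurable_space[OF Z']
    by (auto simp: W_def V_def grid_event_def sumY Z'_eval Z_def space_pair_measure)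
  have "emeasure M (grid_event t S k \<inter> {\<omega> \<in> space M. B T \<omega> \<in> {a..b}})
      = emeasure (distr M P Y \<Otimes>\<^sub>M distr M Q Z') W"
    unfolding ev joint using Y Z' W by (subst emeasure_distr) auto
  also have "\<dots> = (\<integral>\<^sup>+y. emeasure (distr M Q Z') (Pair y -` W) \<partial>distr M P Y)"
    using W by (intro Zs.emeasure_pair_measure_alt) (auto cong: sets_pair_measure_cong)
  also have "\<dots> = (\<integral>\<^sup>+y. indicator V y * ennreal (gauss_interval (T - t k) a b (\<Sum>i\<le>k. y i)) \<partial>distr M P Y)"
  proof (rule nn_integral_cong)
    fix y assume "y \<in> space (distr M P Y)"
    then have y: "y \<in> space P" by simp
    show "emeasure (distr M Q Z') (Pair y -` W)
      = indicator V y * ennreal (gauss_interval (T - t k) a b (\<Sum>i\<le>k. y i))"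
    proof (cases "y \<in> V")
      case True
      then have "Pair y -` W = {z \<in> space Q. (\<Sum>i\<le>k. y i) + z (Suc k) \<in> {a..b}}"
        using y by (auto simp: W_def space_pair_measure)
      moreover have "\<dots> \<in> sets Q" by measurable
      ultimately have "emeasure (distr M Q Z') (Pair y -` W)
        = emeasure M (Z' -` {z \<in> space Q. (\<Sum>i\<le>k. y i) + z (Suc k) \<in> {a..b}} \<inter> space M)"
        using Z' by (simp add: emeasure_distr)
      also have "\<dots> = emeasure M (Z -` {z. (\<Sum>i\<le>k. y i) + z \<in> {a..b}} \<inter> space M)"
        using measurable_space[OF Z'] by (intro arg_cong[where f="emeasure M"]) (auto simp: Z'_eval)
      also have "\<dots> = emeasure (distr M borel Z) {z. (\<Sum>i\<le>k. y i) + z \<in> {a..b}}"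
        using Z by (subst emeasure_distr) auto
      finally show ?thesis
        using True tk t0 emeasure_centered_normal_shift[of "T - t k" "\<Sum>i\<le>k. y i" a b]
        unfolding Z_def by (subst (asm) distr_increment) auto
    next
      case False
      then have "Pair y -` W = {}" by (auto simp: W_def)
      then show ?thesis using False by simp
    qed
  qed
  also have "\<dots> = (\<integral>\<^sup>+\<omega>. indicator V (Y \<omega>) * ennreal (gauss_interval (T - t k) a b (\<Sum>i\<le>k. Y \<omega> i)) \<partial>M)"
  proof (rule nn_integral_distr[OF Y])
    note V[measurable]
    have [measurable]: "(\<lambda>y. \<Sum>i\<le>k. y i) \<in> borel_measurable P"
      unfolding P_def by (intro borel_measurable_sum) auto
    show "(\<lambda>y. indicator V y * ennreal (gauss_interval (T - t k) a b (\<Sum>i\<le>k. y i)))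
      \<in> borel_measurable (distr M P Y)" by measurable
  qed
  also have "\<dots> = (\<integral>\<^sup>+\<omega>. ennreal (indicator (grid_event t S k) \<omega> *
      gauss_interval (T - t k) a b (B (t k) \<omega>)) \<partial>M)"
    by (intro nn_integral_cong) (auto simp: YV sumY gauss_interval_nonneg ennreal_mult ennreal_indicator)
  finally have em: "emeasure M (grid_event t S k \<inter> {\<omega> \<in> space M. B T \<omega> \<in> {a..b}}) = \<dots>" .
  show ?thesis
  proof -
    note grid_event_sets[OF t S, measurable] measurable_B[OF t0, measurable]
    have "(LINT \<omega>|M. indicator (grid_event t S k) \<omega> * gauss_interval (T - t k) a b (B (t k) \<omega>))
      = enn2real (\<integral>\<^sup>+\<omega>. ennreal (indicator (grid_event t S k) \<omega> *
      gauss_interval (T - t k) a b (B (t k) \<omega>)) \<partial>M)"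
      by (rule integral_eq_nn_integral) (auto simp: gauss_interval_nonneg)
    then show ?thesis
      using em by (simp add: measure_def)
  qed
qed

lemma grid_event_Suc: "grid_event t S (Suc k) = grid_event t S k \<inter> {\<omega> \<in> space M. B (t (Suc k)) \<omega> \<in> S (Suc k)}"
  by (auto simp: grid_event_def le_Suc_eq)

section \<open>The reflection estimate on a grid\<close>

lemma integrable_gauss_interval:
  assumes "E \<in> events" "0 \<le> s" "0 < T"
  shows "integrable M (\<lambda>\<omega>. indicator E \<omega> * gauss_interval T a b (B s \<omega>))"
proof (rule integrable_const_bound)
  note measurable_B[OF assms(2), measurable] assms(1)[measurable]
  show "(\<lambda>\<omega>. indicator E \<omega> * gauss_interval T a b (B s \<omega>)) \<in> borel_measurable M" by measurable
  have "gauss_interval T a b y \<le> (LINT x|lborel. normal_density y (sqrt T) x)" for y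
    unfolding gauss_interval_def set_lebesgue_integral_def using assms(3)
    by (intro integral_mono integrable_mult_indicator integrable_normal_density)
       (auto simp: indicator_def)
  then have "gauss_interval T a b y \<le> 1" for y
    using assms(3) by (simp add: integral_normal_density)
  then show "AE \<omega> in M. norm (indicator E \<omega> * gauss_interval T a b (B s \<omega>)) \<le> 1"
    using gauss_interval_nonneg by (auto simp: indicator_def)
qed

text \<open>
  The function \<open>indicator {a..b} - indicator {2 * L - b..2 * L - a}\<close> is antisymmetric about \<open>L\<close>,
  so its conditional expectation given a position \<open>\<le> L\<close> is nonpositive: killing at grid times
  only increases its expectation. No overshoot at the discrete crossing time has to be controlled.
\<close>

lemma grid_reflection:
  assumes t: "t 0 = 0" "mono t" "\<And>k. k < n \<Longrightarrow> t k < t n"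
    and S: "\<And>j. S j \<in> sets borel" "S n = {a..b}" "\<And>j. m < j \<Longrightarrow> j < n \<Longrightarrow> S j = {L<..}"
    and "m < n" "L < a"
  shows "(LINT \<omega>|M. indicator (grid_event t S m) \<omega> *
      (gauss_interval (t n - t m) a b (B (t m) \<omega>) - gauss_interval (t n - t m) a b (2 * L - B (t m) \<omega>)))
    \<le> prob (grid_event t S n)"
proof -
  define I where "I = {\<omega> \<in> space M. B (t n) \<omega> \<in> {a..b}}"
  define J where "J = {\<omega> \<in> space M. B (t n) \<omega> \<in> {2 * L - b..2 * L - a}}"
  \<comment> \<open>The expectation over \<open>E\<close> of the antisymmetric function evaluated at
    the final position.\<close>
  define \<Phi> where "\<Phi> E = prob (E \<inter> I) - prob (E \<inter> J)" for E
  have t0: "0 \<le> t j" for j using monoD[OF t(2), of 0 j] t(1) by simp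
  note measurable_B[OF t0, measurable]
  have [measurable]: "I \<in> events" "J \<in> events" unfolding I_def J_def by measurable
  have \<Phi>: "\<Phi> (grid_event t R k) = (LINT \<omega>|M. indicator (grid_event t R k) \<omega> *
      (gauss_interval (t n - t k) a b (B (t k) \<omega>) - gauss_interval (t n - t k) a b (2 * L - B (t k) \<omega>)))"
    if "k < n" "\<And>j. R j \<in> sets borel" for R k
  proof -
    have E: "grid_event t R k \<in> events" using t that by (intro grid_event_sets) auto
    have "\<Phi> (grid_event t R k)
      = (LINT \<omega>|M. indicator (grid_event t R k) \<omega> * gauss_interval (t n - t k) a b (B (t k) \<omega>))
      - (LINT \<omega>|M. indicator (grid_event t R k) \<omega> * gauss_interval (t n - t k) (2 * L - b) (2 * L - a) (B (t k) \<omega>))"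
      unfolding \<Phi>_def I_def J_def using t that by (subst (1 2) grid_markov) auto
    also have "\<dots> = (LINT \<omega>|M. indicator (grid_event t R k) \<omega> * gauss_interval (t n - t k) a b (B (t k) \<omega>)
      - indicator (grid_event t R k) \<omega> * gauss_interval (t n - t k) (2 * L - b) (2 * L - a) (B (t k) \<omega>))"
      using E t0 t(3)[OF that(1)]
      by (intro Bochner_Integration.integral_diff[symmetric] integrable_gauss_interval) auto
    finally show ?thesis by (simp only: gauss_interval_reflect right_diff_distrib)
  qed
  have step: "\<Phi> (grid_event t S k) \<le> \<Phi> (grid_event t S (Suc k))" if k: "m \<le> k" "Suc k < n" for k
  proof -
    \<comment> \<open>The paths lost in this step: within \<open>S\<close> up to index
      \<open>k\<close>, then at or below \<open>L\<close> at index \<open>Suc k\<close>.\<close>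
    define R where "R = S(Suc k := {..L})"
    have R: "R j \<in> sets borel" for j using S(1) by (simp add: R_def)
    let ?G = "grid_event t S (Suc k)" and ?H = "grid_event t R (Suc k)"
    have [measurable]: "?G \<in> events" "?H \<in> events" using t S R by (auto intro: grid_event_sets)
    have dec: "grid_event t S k = ?G \<union> ?H" "?G \<inter> ?H = {}"
      using k S(3)[of "Suc k"] by (auto simp: grid_event_def R_def le_Suc_eq)
    have "prob (grid_event t S k \<inter> A) = prob (?G \<inter> A) + prob (?H \<inter> A)" if [measurable]: "A \<in> events" for A
      unfolding dec(1) Int_Un_distrib2 using dec(2) by (intro finite_measure_Union) auto
    then have "\<Phi> (grid_event t S k) = \<Phi> ?G + \<Phi> ?H"
      by (simp add: \<Phi>_def)
    moreover have "\<Phi> ?H \<le> 0"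
    proof -
      have "indicator ?H \<omega> * (gauss_interval (t n - t (Suc k)) a b (B (t (Suc k)) \<omega>)
          - gauss_interval (t n - t (Suc k)) a b (2 * L - B (t (Suc k)) \<omega>)) \<le> 0" for \<omega>
      proof (cases "\<omega> \<in> ?H")
        case True
        then have "B (t (Suc k)) \<omega> \<le> L" by (auto simp: grid_event_def R_def)
        then show ?thesis
          using gauss_interval_reflect_le[of "t n - t (Suc k)" "B (t (Suc k)) \<omega>" L a b] t(3)[of "Suc k"] k \<open>L < a\<close>
          by (simp add: indicator_def)
      qed simp
      then have "0 \<le> (LINT \<omega>|M. - (indicator ?H \<omega> * (gauss_interval (t n - t (Suc k)) a b (B (t (Suc k)) \<omega>)
          - gauss_interval (t n - t (Suc k)) a b (2 * L - B (t (Suc k)) \<omega>))))"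
        by (intro integral_nonneg_AE) simp
      then show ?thesis using \<Phi>[OF k(2) R] by simp
    qed
    ultimately show ?thesis by simp
  qed
  have mono: "\<Phi> (grid_event t S m) \<le> \<Phi> (grid_event t S (m + i))" if "m + i < n" for i
    using that
  proof (induction i)
    case (Suc i)
    then show ?case using step[of "m + i"] by simp
  qed simp
  \<comment> \<open>Killing stops at index \<open>n - 1\<close>, since at \<open>n\<close> the
    constraint is \<open>{a..b}\<close> itself: the negative part of \<open>\<Phi>\<close> is
    dropped and intersecting with \<open>I\<close> gives the event at \<open>n\<close>.\<close>
  define q where "q = n - 1"
  have q: "n = Suc q" "m \<le> q" using \<open>m < n\<close> by (auto simp: q_def)
  have "\<Phi> (grid_event t S m) \<le> \<Phi> (grid_event t S q)"
    using mono[of "q - m"] q by simp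
  also have "\<dots> \<le> prob (grid_event t S q \<inter> I)" by (simp add: \<Phi>_def)
  also have "grid_event t S q \<inter> I = grid_event t S n"
    unfolding I_def q(1) grid_event_Suc using S(2) q(1) by simp
  finally show ?thesis using \<Phi>[OF \<open>m < n\<close> S(1)] by simp
qed

text \<open>On the event at index \<open>m\<close> the path has clearance at least
  \<open>\<eta>\<close>, so the reflected kernel is bounded below by a constant that does not depend
  on how fine the grid is. Before index \<open>m\<close> only measurability of the constraints is
  asked, which allows two stages to be chained.\<close>

lemma grid_survival:
  assumes t: "t 0 = 0" "mono t" "\<And>k. k < n \<Longrightarrow> t k < t n"
    and S: "\<And>j. S j \<in> sets borel" "S n = {a..b}" "\<And>j. m < j \<Longrightarrow> j < n \<Longrightarrow> S j = {L<..}"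
      "S m \<subseteq> {L + \<eta>..L + D}"
    and "m < n" "L < a" "a \<le> b" "b \<le> L + D" "0 < \<eta>"
    and T: "0 < T1" "T1 \<le> t n - t m" "t n - t m \<le> T2"
  shows "kernel_const D T1 T2 * \<eta> * (a - L) * (b - a) * prob (grid_event t S m) \<le> prob (grid_event t S n)"
proof -
  let ?E = "grid_event t S m" and ?c = "kernel_const D T1 T2 * \<eta> * (a - L) * (b - a)"
  let ?g = "\<lambda>\<omega>. gauss_interval (t n - t m) a b (B (t m) \<omega>) - gauss_interval (t n - t m) a b (2 * L - B (t m) \<omega>)"
  have E: "?E \<in> events" using t S by (intro grid_event_sets) auto
  have t0: "0 \<le> t j" for j using monoD[OF t(2), of 0 j] t(1) by simp
  have K: "0 < kernel_const D T1 T2" using T by (intro kernel_const_pos) auto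
  have "?c * prob ?E = (LINT \<omega>|M. ?c * indicator ?E \<omega>)"
    using E by simp
  also have "\<dots> \<le> (LINT \<omega>|M. indicator ?E \<omega> * ?g \<omega>)"
  proof (rule integral_mono)
    show "integrable M (\<lambda>\<omega>. ?c * indicator ?E \<omega>)"
      using E by (intro integrable_mult_right integrable_real_indicator) (auto simp: emeasure_eq_measure)
    have "integrable M (\<lambda>\<omega>. indicator ?E \<omega> * gauss_interval (t n - t m) a b (B (t m) \<omega>)
      - indicator ?E \<omega> * gauss_interval (t n - t m) (2 * L - b) (2 * L - a) (B (t m) \<omega>))"
      using E t0 T by (intro Bochner_Integration.integrable_diff integrable_gauss_interval) auto
    then show "integrable M (\<lambda>\<omega>. indicator ?E \<omega> * ?g \<omega>)"
      by (simp only: gauss_interval_reflect right_diff_distrib)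
    fix \<omega> assume "\<omega> \<in> space M"
    show "?c * indicator ?E \<omega> \<le> indicator ?E \<omega> * ?g \<omega>"
    proof (cases "\<omega> \<in> ?E")
      case True
      then have y: "L + \<eta> \<le> B (t m) \<omega>" "B (t m) \<omega> \<le> L + D"
        using S(4) by (auto simp: grid_event_def)
      have "?c \<le> kernel_const D T1 T2 * ((a - L) * (B (t m) \<omega> - L)) * (b - a)"
      proof -
        have "\<eta> * (a - L) \<le> (a - L) * (B (t m) \<omega> - L)"
          using y \<open>L < a\<close> by (subst mult.commute) (intro mult_left_mono, auto)
        then show ?thesis
          using K \<open>a \<le> b\<close> by (simp only: mult.assoc) (intro mult_left_mono mult_right_mono, auto simp: mult.assoc[symmetric] intro!: mult_right_mono)
      qed
      also have "\<dots> \<le> ?g \<omega>"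
        using assms y by (intro gauss_interval_reflect_diff_ge) auto
      finally show ?thesis using True by simp
    qed simp
  qed
  also have "\<dots> \<le> prob (grid_event t S n)"
    using assms by (intro grid_reflection) auto
  finally show ?thesis .
qed

section \<open>Survival above the moving barrier\<close>

text \<open>Strict inequality at rational times would not exclude contact at an irrational one. A
  uniform gap \<open>inverse (real (Suc k))\<close> does, and it turns survival into a countable
  union of countable intersections.\<close>

lemma survival_event_measurable:
  assumes "mono_on {0..} \<Lambda>" "\<And>v. 0 \<le> v \<Longrightarrow> continuous (at_right v) \<Lambda>" "0 \<le> t"
  shows "{\<omega> \<in> space M. ereal t < hitting_time B \<Lambda> \<omega>} \<in> events"
proof -
  let ?Q = "(\<rat> \<inter> {0..t}) \<union> {t}"
  have "{\<omega> \<in> space M. ereal t < hitting_time B \<Lambda> \<omega>}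
    = (\<Union>k::nat. \<Inter>q\<in>?Q. {\<omega> \<in> space M. \<Lambda> q + inverse (real (Suc k)) \<le> B q \<omega>})" (is "?L = ?R")
  proof (intro equalityI subsetI)
    fix \<omega> assume "\<omega> \<in> ?L"
    then have \<omega>: "\<omega> \<in> space M" and "\<forall>v\<in>{0..t}. \<Lambda> v < B v \<omega>"
      using hitting_time_gt_iff[of t B \<omega> \<Lambda>] continuous_path assms by auto
    then obtain k :: nat where "\<forall>v\<in>{0..t}. \<Lambda> v + inverse (real (Suc k)) \<le> B v \<omega>"
      using uniform_gap_above_barrier[OF assms(1,2) continuous_path, of \<omega> t] by auto
    then have "\<forall>q\<in>?Q. \<Lambda> q + inverse (real (Suc k)) \<le> B q \<omega>" using assms(3) by auto
    then show "\<omega> \<in> ?R" using \<omega> by blast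
  next
    fix \<omega> assume "\<omega> \<in> ?R"
    then obtain k :: nat where k: "\<And>q. q \<in> ?Q \<Longrightarrow> \<Lambda> q + inverse (real (Suc k)) \<le> B q \<omega>"
      and \<omega>: "\<omega> \<in> space M" by blast
    have "\<Lambda> v + inverse (real (Suc k)) \<le> B v \<omega>" if "v \<in> {0..t}" for v
      using barrier_gap_from_rationals[OF assms(1) continuous_path[OF \<omega>] k that] .
    then have "\<Lambda> v < B v \<omega>" if "v \<in> {0..t}" for v
      using that by (smt (verit) inverse_positive_iff_positive of_nat_0_less_iff zero_less_Suc)
    then show "\<omega> \<in> ?L"
      using hitting_time_gt_iff[of t B \<omega> \<Lambda>] continuous_path \<omega> assms by auto
  qed
  also have "?R \<in> events"
  proof (rule sets.countable_UN, safe)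
    fix k :: nat
    show "(\<Inter>q\<in>?Q. {\<omega> \<in> space M. \<Lambda> q + inverse (real (Suc k)) \<le> B q \<omega>}) \<in> events"
    proof (rule sets.countable_INT')
      show "countable ?Q" using countable_rat by auto
      have "{\<omega> \<in> space M. \<Lambda> q + inverse (real (Suc k)) \<le> B q \<omega>} \<in> events" if "q \<in> ?Q" for q
      proof -
        have [measurable]: "B q \<in> borel_measurable M" using that assms(3) by (intro measurable_B) auto
        show ?thesis by measurable
      qed
      then show "(\<lambda>q. {\<omega> \<in> space M. \<Lambda> q + inverse (real (Suc k)) \<le> B q \<omega>}) ` ?Q \<subseteq> events"
        by blast
    qed simp
  qed
  finally show ?thesis .
qed

text \<open>
  The barrier is bounded by \<open>L1\<close> on \<open>[0, \<epsilon>]\<close> and by \<open>L2\<close> on \<open>[\<epsilon>, t]\<close>; at time \<open>\<epsilon>\<close> the path is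
  required to be in \<open>{K..K + 1}\<close>, safely above both. The parametrisation \<open>\<psi>\<close> maps \<open>[0, 1]\<close> onto
  \<open>[0, \<epsilon>]\<close> and \<open>[1, 2]\<close> onto \<open>[\<epsilon>, t]\<close>, so that \<open>\<epsilon>\<close> and \<open>t\<close> belong to all dyadic grids.
\<close>

lemma survival_lower_bound:
  assumes \<Lambda>: "mono_on {0..} \<Lambda>" "\<And>v. 0 \<le> v \<Longrightarrow> continuous (at_right v) \<Lambda>"
    and \<epsilon>: "0 < \<epsilon>" "\<epsilon> < t" and L: "\<Lambda> \<epsilon> < L1" "\<Lambda> t < L2"
    and K: "0 < \<eta>" "L1 < K" "K + 1 \<le> L1 + D1" "L2 + 1 \<le> K" "K + 1 \<le> L2 + D"
    and ab: "L2 < a" "a \<le> b" "b \<le> L2 + D"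
    and T: "0 < T1" "T1 \<le> t - \<epsilon>" "t - \<epsilon> \<le> T2"
  shows "kernel_const D T1 T2 * (a - L2) * (b - a) *
      (kernel_const D1 \<epsilon> \<epsilon> * \<eta> * (K - L1) * prob {\<omega> \<in> space M. B 0 \<omega> \<in> {L1 + \<eta>..L1 + D1}})
    \<le> prob {\<omega> \<in> space M. B t \<omega> \<in> {a..b} \<and> ereal t < hitting_time B \<Lambda> \<omega>}"
proof -
  define \<psi> where "\<psi> x = (if x \<le> 1 then \<epsilon> * x else \<epsilon> + (t - \<epsilon>) * (min x 2 - 1))" for x :: real
  define S where "S x = (if x \<le> 0 then {L1 + \<eta>..L1 + D1} else if x < 1 then {L1<..}
    else if x = 1 then {K..K + 1} else if x < 2 then {L2<..} else {a..b})" for x :: real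
  \<comment> \<open>Times and constraints are both read off the dyadic parameter
    \<open>j / 2 ^ N\<close>. Every grid therefore reappears at the even indices of the next one,
    which makes \<open>E\<close> decreasing.\<close>
  define \<tau> where "\<tau> N j = \<psi> (real j / 2 ^ N)" for N j :: nat
  define R where "R N j = S (real j / 2 ^ N)" for N j :: nat
  define E where "E N = grid_event (\<tau> N) (R N) (2 * 2 ^ N)" for N
  have \<psi>_mono: "\<psi> x \<le> \<psi> y" if "x \<le> y" for x y
  proof -
    have "\<epsilon> * x \<le> \<epsilon>" if "x \<le> 1" for x using \<epsilon> that by (simp add: mult_left_le)
    moreover have "0 \<le> (t - \<epsilon>) * (min y 2 - 1)" if "1 \<le> y" using \<epsilon> that by auto
    ultimately show ?thesis
      using that \<epsilon> unfolding \<psi>_def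
      by (auto intro!: mult_left_mono simp: add_increasing2 intro: order_trans)
  qed
  have \<tau>: "\<tau> N 0 = 0" "mono (\<tau> N)" "\<tau> N (2 ^ N) = \<epsilon>" "\<tau> N (2 * 2 ^ N) = t" for N
  proof -
    show "mono (\<tau> N)"
      unfolding \<tau>_def by (intro monoI \<psi>_mono divide_right_mono) auto
  qed (auto simp: \<tau>_def \<psi>_def)
  have \<tau>1: "\<tau> N j < \<epsilon>" if "j < 2 ^ N" for N j
  proof -
    have "real j < 2 ^ N" using that by simp
    then show ?thesis using \<epsilon> by (simp add: \<tau>_def \<psi>_def field_simps)
  qed
  have \<tau>2: "\<tau> N j < t" if "j < 2 * 2 ^ N" for N j
  proof -
    have "real j < real (2 * 2 ^ N)" using that by (simp only: of_nat_less_iff)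
    then have "real j < 2 * 2 ^ N" by simp
    then have x: "real j / 2 ^ N < 2" by (simp add: field_simps)
    show ?thesis
    proof (cases "real j / 2 ^ N \<le> 1")
      case True
      then have "\<epsilon> * (real j / 2 ^ N) \<le> \<epsilon>" using \<epsilon> by (simp only: mult_left_le)
      then show ?thesis using True \<epsilon> unfolding \<tau>_def \<psi>_def by simp
    next
      case False
      have "(t - \<epsilon>) * (real j / 2 ^ N - 1) < (t - \<epsilon>) * 1"
        using x \<epsilon> by (intro mult_strict_left_mono) auto
      then show ?thesis using False x unfolding \<tau>_def \<psi>_def by simp
    qed
  qed
  have R: "R N j \<in> sets borel" for N j by (simp add: R_def S_def)
  have dj: "real j / 2 ^ N < 1 \<longleftrightarrow> j < 2 ^ N" "real j / 2 ^ N < 2 \<longleftrightarrow> j < 2 * 2 ^ N"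
    "1 < real j / 2 ^ N \<longleftrightarrow> 2 ^ N < j" for N j :: nat
  proof -
    have "real j < real (2 * 2 ^ N) \<longleftrightarrow> j < 2 * 2 ^ N" by (rule of_nat_less_iff)
    then have "real j < 2 * 2 ^ N \<longleftrightarrow> j < 2 * 2 ^ N" by (simp only: of_nat_mult of_nat_power of_nat_numeral)
    moreover have "real j < 2 ^ N \<longleftrightarrow> j < 2 ^ N" "2 ^ N < real j \<longleftrightarrow> 2 ^ N < j" by simp_all
    ultimately show "real j / 2 ^ N < 1 \<longleftrightarrow> j < 2 ^ N" "real j / 2 ^ N < 2 \<longleftrightarrow> j < 2 * 2 ^ N"
      "1 < real j / 2 ^ N \<longleftrightarrow> 2 ^ N < j" by (simp_all add: field_simps)
  qed
  have RK: "R N (2 ^ N) = {K..K + 1}" and Rab: "R N (2 * 2 ^ N) = {a..b}"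
    and R0: "R N 0 = {L1 + \<eta>..L1 + D1}" for N
    by (auto simp: R_def S_def)
  have R1: "R N j = {L1<..}" if "0 < j" "j < 2 ^ N" for N j
  proof -
    have "0 < real j / 2 ^ N" using that by simp
    then have "\<not> real j / 2 ^ N \<le> 0" by linarith
    moreover have "real j / 2 ^ N < 1" using that dj(1)[of j N] by simp
    ultimately show ?thesis by (simp only: R_def S_def if_True if_False)
  qed
  have R2: "R N j = {L2<..}" if "2 ^ N < j" "j < 2 * 2 ^ N" for N j
  proof -
    have "1 < real j / 2 ^ N" "real j / 2 ^ N < 2" using that dj(2)[of j N] dj(3)[of N j] by simp_all
    moreover from this(1) have "\<not> real j / 2 ^ N \<le> 0" "\<not> real j / 2 ^ N < 1" "real j / 2 ^ N \<noteq> 1"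
      by linarith+
    ultimately show ?thesis by (simp only: R_def S_def if_True if_False)
  qed
  let ?p = "kernel_const D1 \<epsilon> \<epsilon> * \<eta> * (K - L1) * prob {\<omega> \<in> space M. B 0 \<omega> \<in> {L1 + \<eta>..L1 + D1}}"
  have bound: "kernel_const D T1 T2 * (a - L2) * (b - a) * ?p \<le> prob (E N)" for N
  proof -
    \<comment> \<open>First stage, from time \<open>0\<close> to \<open>\<epsilon>\<close> above the
      level \<open>L1\<close>; the target \<open>{K..K + 1}\<close> has width one.\<close>
    have "kernel_const D1 \<epsilon> \<epsilon> * \<eta> * (K - L1) * (K + 1 - K) * prob (grid_event (\<tau> N) (R N) 0)
      \<le> prob (grid_event (\<tau> N) (R N) (2 ^ N))"
      using R R0 RK R1 \<tau> \<tau>1 K \<epsilon> by (intro grid_survival) auto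
    moreover have "grid_event (\<tau> N) (R N) 0 = {\<omega> \<in> space M. B 0 \<omega> \<in> {L1 + \<eta>..L1 + D1}}"
      by (simp add: grid_event_def \<tau> R0)
    ultimately have p: "?p \<le> prob (grid_event (\<tau> N) (R N) (2 ^ N))" by simp
    have "0 < kernel_const D T1 T2" using T by (intro kernel_const_pos) auto
    \<comment> \<open>Second stage, above \<open>L2\<close>. The explicit factor \<open>1\<close> is
      its clearance, available because \<open>L2 + 1 \<le> K\<close>.\<close>
    then have "kernel_const D T1 T2 * (a - L2) * (b - a) * ?p
      \<le> kernel_const D T1 T2 * 1 * (a - L2) * (b - a) * prob (grid_event (\<tau> N) (R N) (2 ^ N))"
      using p ab by (simp only: mult_1_right) (intro mult_left_mono, auto)
    also have "\<dots> \<le> prob (E N)"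
      unfolding E_def using R Rab RK R2 \<tau> \<tau>2 K ab T by (intro grid_survival) auto
    finally show ?thesis .
  qed
  have E_events: "E N \<in> events" for N unfolding E_def using \<tau> R by (intro grid_event_sets) auto
  have "decseq E"
  proof (rule decseq_SucI, rule subsetI)
    fix N \<omega> assume \<omega>: "\<omega> \<in> E (Suc N)"
    have "B (\<tau> N j) \<omega> \<in> R N j" if "j \<le> 2 * 2 ^ N" for j
    proof -
      have "B (\<tau> (Suc N) (2 * j)) \<omega> \<in> R (Suc N) (2 * j)"
        using \<omega> that by (auto simp: E_def grid_event_def)
      then show ?thesis by (simp add: \<tau>_def R_def)
    qed
    then show "\<omega> \<in> E N" using \<omega> by (auto simp: E_def grid_event_def)
  qed
  then have "(\<lambda>N. prob (E N)) \<longlonglongrightarrow> prob (\<Inter>N. E N)"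
    using E_events by (intro finite_Lim_measure_decseq) auto
  then have "kernel_const D T1 T2 * (a - L2) * (b - a) * ?p \<le> prob (\<Inter>N. E N)"
    using bound by (intro LIMSEQ_le_const) auto
  also have "\<dots> \<le> prob {\<omega> \<in> space M. B t \<omega> \<in> {a..b} \<and> ereal t < hitting_time B \<Lambda> \<omega>}"
  proof (rule finite_measure_mono)
    have [measurable]: "B t \<in> borel_measurable M" using \<epsilon> by (intro measurable_B) auto
    have [measurable]: "{\<omega> \<in> space M. ereal t < hitting_time B \<Lambda> \<omega>} \<in> events"
      using \<Lambda> \<epsilon> by (intro survival_event_measurable) auto
    have "{\<omega> \<in> space M. B t \<omega> \<in> {a..b}} \<inter> {\<omega> \<in> space M. ereal t < hitting_time B \<Lambda> \<omega>} \<in> events"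
      by measurable
    also have "{\<omega> \<in> space M. B t \<omega> \<in> {a..b}} \<inter> {\<omega> \<in> space M. ereal t < hitting_time B \<Lambda> \<omega>}
      = {\<omega> \<in> space M. B t \<omega> \<in> {a..b} \<and> ereal t < hitting_time B \<Lambda> \<omega>}" by auto
    finally show "{\<omega> \<in> space M. B t \<omega> \<in> {a..b} \<and> ereal t < hitting_time B \<Lambda> \<omega>} \<in> events" .
    show "(\<Inter>N. E N) \<subseteq> {\<omega> \<in> space M. B t \<omega> \<in> {a..b} \<and> ereal t < hitting_time B \<Lambda> \<omega>}"
    proof
      fix \<omega> assume "\<omega> \<in> (\<Inter>N. E N)"
      then have \<omega>: "\<omega> \<in> space M" and grid: "\<And>N j. j \<le> 2 * 2 ^ N \<Longrightarrow> B (\<tau> N j) \<omega> \<in> R N j"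
        by (auto simp: E_def grid_event_def)
      have Bt: "B t \<omega> \<in> {a..b}" and B\<epsilon>: "B \<epsilon> \<omega> \<in> {K..K + 1}"
        using grid[of "2 * 2 ^ 0" 0] grid[of "2 ^ 0" 0] \<tau>(3,4)[of 0] RK[of 0] Rab[of 0] by auto
      note path = continuous_path[OF \<omega>]
      have "\<Lambda> v < B v \<omega>" if v: "v \<in> {0..t}" for v
      proof (rule ccontr)
        assume neg: "\<not> \<Lambda> v < B v \<omega>"
        consider "v < \<epsilon>" | "v = \<epsilon>" | "\<epsilon> < v" "v < t" | "v = t" using v by force
        then show False
        proof cases
          case 1
          have "\<Lambda> v \<le> \<Lambda> \<epsilon>" using v 1 by (intro mono_onD[OF \<Lambda>(1)]) auto
          then have "B v \<omega> < L1" using neg L by linarith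
          then obtain c where c: "v < c" "\<And>y. v \<le> y \<Longrightarrow> y < c \<Longrightarrow> B y \<omega> < L1"
            using continuous_on_less_right[OF path, of v L1] v by auto
          \<comment> \<open>\<open>v / \<epsilon>\<close> is the parameter of time \<open>v\<close>.
            The cap \<open>min c \<epsilon>\<close> keeps the dyadic point before
            \<open>\<epsilon>\<close>, where values above \<open>L1\<close> are demanded; lying
            strictly after \<open>v\<close> forces \<open>j > 0\<close>.\<close>
          have "v / \<epsilon> < min c \<epsilon> / \<epsilon>" "0 \<le> v / \<epsilon>"
            using c 1 \<epsilon> v by (auto intro!: divide_strict_right_mono)
          then obtain N j where Nj: "v / \<epsilon> < real j / 2 ^ N" "real j / 2 ^ N < min c \<epsilon> / \<epsilon>"
            using dyadic_between by metis
          have y: "v < \<epsilon> * (real j / 2 ^ N)" "\<epsilon> * (real j / 2 ^ N) < min c \<epsilon>"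
            using Nj \<epsilon> by (auto simp: field_simps)
          have "real j / 2 ^ N < 1" using y(2) \<epsilon> by (metis min_less_iff_conj mult.right_neutral mult_less_cancel_left_pos)
          moreover have "0 < real j / 2 ^ N" using Nj(1) \<open>0 \<le> v / \<epsilon>\<close> by linarith
          ultimately have "j < 2 ^ N" "0 < j" "\<tau> N j = \<epsilon> * (real j / 2 ^ N)"
            using dj(1)[of j N] by (auto simp: \<tau>_def \<psi>_def intro!: gr0I)
          then show False using grid[of j N] R1[of j N] c(2)[of "\<tau> N j"] y by auto
        next
          case 2
          then show False using neg B\<epsilon> K L by auto
        next
          case 3
          have "\<Lambda> v \<le> \<Lambda> t" using v 3 by (intro mono_onD[OF \<Lambda>(1)]) auto
          then have "B v \<omega> < L2" using neg L by linarith
          then obtain c where c: "v < c" "\<And>y. v \<le> y \<Longrightarrow> y < c \<Longrightarrow> B y \<omega> < L2"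
            using continuous_on_less_right[OF path, of v L2] v by auto
          define s where "s = t - \<epsilon>"
          have s: "0 < s" using \<epsilon> by (simp add: s_def)
          \<comment> \<open>The same search on the second branch of \<open>\<psi>\<close>, where
            time \<open>v\<close> has parameter \<open>1 + (v - \<epsilon>) / s\<close>.\<close>
          have "1 + (v - \<epsilon>) / s < 1 + (min c t - \<epsilon>) / s" "0 \<le> 1 + (v - \<epsilon>) / s"
            using c 3 s by (auto intro!: divide_strict_right_mono add_nonneg_nonneg)
          then obtain N j where Nj: "1 + (v - \<epsilon>) / s < real j / 2 ^ N"
              "real j / 2 ^ N < 1 + (min c t - \<epsilon>) / s"
            using dyadic_between by metis
          define x where "x = real j / 2 ^ N"
          have y: "v < \<epsilon> + s * (x - 1)" "\<epsilon> + s * (x - 1) < min c t"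
            using Nj s unfolding x_def[symmetric] by (auto simp: field_simps)
          have "0 < (v - \<epsilon>) / s" using 3 s by simp
          then have x1: "1 < x" using Nj(1) unfolding x_def by linarith
          have "s * (x - 1) < s * 1" using y(2) by (simp add: s_def)
          then have x2: "x < 2" using s by simp
          have "2 ^ N < j" "j < 2 * 2 ^ N" "\<tau> N j = \<epsilon> + s * (x - 1)"
            using x1 x2 dj(2,3)[of j N] dj(3)[of N j] unfolding \<tau>_def \<psi>_def x_def s_def by auto
          then show False using grid[of j N] R2[of N j] c(2)[of "\<tau> N j"] y by auto
        next
          case 4
          then show False using neg Bt ab L by auto
        qed
      qed
      then show "\<omega> \<in> {\<omega> \<in> space M. B t \<omega> \<in> {a..b} \<and> ereal t < hitting_time B \<Lambda> \<omega>}"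
        using \<omega> Bt \<epsilon> \<Lambda>(2)[of t] hitting_time_gt_iff[of t B \<omega> \<Lambda>] path by auto
    qed
  qed
  finally show ?thesis .
qed

section \<open>Initial mass above the barrier\<close>

text \<open>Countably many such windows cover the half-line above \<open>c\<close>, so they cannot
  all be null. One \<open>\<eta>\<close> raises the level above \<open>c\<close>, the other is the
  clearance above the raised level; \<open>D0\<close> lets the window be as tall as
  required.\<close>

lemma prob_start_in_interval_pos:
  assumes "0 < prob {\<omega> \<in> space M. c < B 0 \<omega>}"
  obtains \<eta> D where "0 < \<eta>" "D0 \<le> D"
    "0 < prob {\<omega> \<in> space M. B 0 \<omega> \<in> {c + \<eta> + \<eta>..c + \<eta> + D}}"
proof (rule ccontr)
  assume neg: "\<not> thesis"
  note witness = that
  have no: "\<not> 0 < prob {\<omega> \<in> space M. B 0 \<omega> \<in> {c + \<eta> + \<eta>..c + \<eta> + D}}"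
    if "0 < \<eta>" "D0 \<le> D" for \<eta> D using witness[OF that] neg by blast
  have [measurable]: "B 0 \<in> borel_measurable M" by (rule measurable_B) simp
  define F where "F k = {\<omega> \<in> space M. B 0 \<omega> \<in> {c + inverse (real (Suc k)) + inverse (real (Suc k))..
    c + inverse (real (Suc k)) + (D0 + real k)}}" for k :: nat
  have F: "F k \<in> null_sets M" for k
  proof (rule null_setsI)
    show "F k \<in> events" unfolding F_def by measurable
    have "\<not> 0 < prob (F k)" unfolding F_def by (rule no) auto
    then have "prob (F k) = 0" using measure_nonneg[of M "F k"] by linarith
    then show "emeasure M (F k) = 0" by (simp add: emeasure_eq_measure)
  qed
  have "{\<omega> \<in> space M. c < B 0 \<omega>} \<subseteq> (\<Union>k. F k)"
  proof
    fix \<omega> assume \<omega>: "\<omega> \<in> {\<omega> \<in> space M. c < B 0 \<omega>}"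
    then have "0 < (B 0 \<omega> - c) / 2" by simp
    then have "eventually (\<lambda>k. inverse (real (Suc k)) < (B 0 \<omega> - c) / 2) sequentially"
      by (rule order_tendstoD(2)[OF LIMSEQ_inverse_real_of_nat])
    moreover have "eventually (\<lambda>k. B 0 \<omega> - c - D0 \<le> real k) sequentially"
      using filterlim_real_sequentially unfolding filterlim_at_top by blast
    ultimately have "eventually (\<lambda>k. inverse (real (Suc k)) < (B 0 \<omega> - c) / 2
      \<and> B 0 \<omega> - c - D0 \<le> real k) sequentially" by (rule eventually_conj)
    then obtain k where k: "inverse (real (Suc k)) < (B 0 \<omega> - c) / 2" "B 0 \<omega> - c - D0 \<le> real k"
      by (auto simp: eventually_sequentially)
    define i where "i = inverse (real (Suc k))"
    have "0 < i" by (simp add: i_def)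
    then have "c + i + i \<le> B 0 \<omega>" "B 0 \<omega> \<le> c + i + (D0 + real k)"
      using k unfolding i_def[symmetric] by simp_all
    then have "\<omega> \<in> F k" using \<omega> unfolding F_def i_def by simp
    then show "\<omega> \<in> (\<Union>k. F k)" by blast
  qed
  moreover have "(\<Union>k. F k) \<in> null_sets M" using F by (intro null_sets_UN) auto
  ultimately have "{\<omega> \<in> space M. c < B 0 \<omega>} \<in> null_sets M"
    by (rule null_sets_subset[rotated 2]) measurable
  then show False using assms by (simp add: measure_eq_0_null_sets)
qed

text \<open>If almost every path started at or below \<open>\<Lambda> 0\<close>, it would be
  absorbed at time \<open>0\<close>, and the solution equation would give
  \<open>\<Lambda> 0 = \<alpha>\<close>.\<close>

lemma prob_start_above_barrier_pos:
  assumes "probabilistic_solution M B \<alpha> \<Lambda>" "0 < \<alpha>" "\<Lambda> 0 < \<alpha>"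
  shows "0 < prob {\<omega> \<in> space M. \<Lambda> 0 < B 0 \<omega>}"
proof (rule ccontr)
  assume "\<not> ?thesis"
  moreover have "0 \<le> prob {\<omega> \<in> space M. \<Lambda> 0 < B 0 \<omega>}" by (rule measure_nonneg)
  ultimately have zero: "prob {\<omega> \<in> space M. \<Lambda> 0 < B 0 \<omega>} = 0" by linarith
  have \<Lambda>: "continuous (at_right 0) \<Lambda>"
    "\<Lambda> 0 = \<alpha> * prob {\<omega> \<in> space M. hitting_time B \<Lambda> \<omega> \<le> ereal 0}"
    using assms(1) by (auto simp: probabilistic_solution_def)
  have [measurable]: "B 0 \<in> borel_measurable M" by (rule measurable_B) simp
  have "{\<omega> \<in> space M. hitting_time B \<Lambda> \<omega> \<le> ereal 0} = space M - {\<omega> \<in> space M. \<Lambda> 0 < B 0 \<omega>}"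
    using hitting_time_gt_iff[of 0 B _ \<Lambda>] continuous_path \<Lambda>(1)
    by (auto simp: not_less[symmetric] simp del: not_less)
  then have "prob {\<omega> \<in> space M. hitting_time B \<Lambda> \<omega> \<le> ereal 0} = 1"
    using zero by (simp add: prob_compl)
  then show False using \<Lambda>(2) assms by simp
qed

end

section \<open>From interval probabilities to the density\<close>

text \<open>Above the barrier \<open>u\<close> is continuous in space, so its averages over
  \<open>{x..b}\<close> tend to \<open>u x t\<close> as \<open>b\<close> decreases to
  \<open>x\<close>.\<close>

lemma associated_density_ge:
  assumes u: "associated_density M B \<Lambda> u" and t: "0 < t" and x: "\<Lambda> t < x" and "0 < \<delta>"
    and le: "\<And>b. x < b \<Longrightarrow> b < x + \<delta> \<Longrightarrow>
      w * (b - x) \<le> measure M {\<omega> \<in> space M. B t \<omega> \<in> {x..b} \<and> ereal t < hitting_time B \<Lambda> \<omega>}"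
  shows "w \<le> u x t"
proof (rule ccontr)
  assume neg: "\<not> w \<le> u x t"
  have "Ck_on 0 (\<lambda>(x, t). u x t) {(x, t). 0 < t \<and> \<Lambda> t < x}"
    using u unfolding associated_density_def smooth_on_def by blast
  then have "continuous_on {(x, t). 0 < t \<and> \<Lambda> t < x} (\<lambda>(x, t). u x t)" by simp
  then have "continuous_on {\<Lambda> t<..} (\<lambda>y. (\<lambda>(x, t). u x t) (y, t))"
    by (rule continuous_on_compose2) (use t in \<open>auto intro!: continuous_intros\<close>)
  then have "isCont (\<lambda>y. u y t) x"
    using x by (simp add: continuous_on_eq_continuous_at)
  define v where "v = (u x t + w) / 2"
  have v: "u x t < v" "v < w" using neg by (auto simp: v_def)
  have "((\<lambda>y. u y t) \<longlongrightarrow> u x t) (at_right x)"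
    using \<open>isCont _ x\<close> by (simp add: isCont_def filterlim_at_split)
  then have "eventually (\<lambda>y. u y t < v) (at_right x)" using v(1) by (rule order_tendstoD)
  then obtain b0 where b0: "x < b0" "\<forall>y>x. y < b0 \<longrightarrow> u y t < v"
    by (auto simp: eventually_at_right_field)
  define b where "b = (x + min b0 (x + \<delta>)) / 2"
  have b: "x < b" "b < b0" "b < x + \<delta>" using b0 \<open>0 < \<delta>\<close> by (auto simp: b_def min_def field_simps)
  have int: "set_integrable lborel {x..b} (\<lambda>y. u y t)"
    and eq: "measure M {\<omega> \<in> space M. B t \<omega> \<in> {x..b} \<and> ereal t < hitting_time B \<Lambda> \<omega>}
      = (LINT y:{x..b}|lborel. u y t)"
    using u t b(1) unfolding associated_density_def by blast+
  have "w * (b - x) \<le> (LINT y:{x..b}|lborel. u y t)" using le[OF b(1,3)] eq by simp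
  also have "\<dots> \<le> (LINT y:{x..b}|lborel. v)"
  proof (rule set_integral_mono[OF int])
    show "set_integrable lborel {x..b} (\<lambda>y. v)"
      by (intro borel_integrable_atLeastAtMost') (rule continuous_on_const)
    fix y assume "y \<in> {x..b}"
    then show "u y t \<le> v" using b0(2)[rule_format, of y] b v(1) by (cases "y = x") auto
  qed
  also have "\<dots> = v * (b - x)" using b(1) by (simp add: set_lebesgue_integral_def)
  finally show False using v(2) b(1) by simp
qed

text \<open>The hypothesis \<open>no_total_freezing_at_0\<close> secures initial mass above the
  barrier. For the uniform law on \<open>[0, \<alpha>]\<close> with constant barrier
  \<open>\<alpha>\<close> the density vanishes at all positive times, and no \<open>c > 0\<close>
  works on a cylinder reaching above \<open>\<alpha>\<close>.\<close>

theorem proposition3p3: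
  fixes M :: "'a measure" and B :: "real \<Rightarrow> 'a \<Rightarrow> real"
    and \<alpha> :: real and u0 :: "real \<Rightarrow> real" and \<Lambda> :: "real \<Rightarrow> real"
    and u :: "real \<Rightarrow> real \<Rightarrow> real" and x0 t0 r :: real
  assumes "\<alpha> > 0"
    and "probability_density_on_half_line u0"
    and "brownian_motion M B"
    and "distributed M lborel (B 0) (\<lambda>x. ennreal (u0 x))"
    and "physical_solution M B \<alpha> \<Lambda>"
    and no_total_freezing_at_0: "\<Lambda> 0 < \<alpha>"
    and "associated_density M B \<Lambda> u"
    and "t0 > 0" and "0 < r" and "r < t0 / 10" and "r\<^sup>2 < t0"
  shows "\<exists>c>0. \<forall>(x, t) \<in> parabolic_cylinder r x0 t0. u x t \<ge> c * max (x - \<Lambda> t) 0"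
proof -
  interpret brownian M B by standard (rule assms(3))
  have sol: "probabilistic_solution M B \<alpha> \<Lambda>"
    using assms(5) by (simp add: physical_solution_def)
  then have mono: "mono_on {0..} \<Lambda>" and nonneg: "\<And>t. 0 \<le> t \<Longrightarrow> 0 \<le> \<Lambda> t"
    and cont: "\<And>t. 0 \<le> t \<Longrightarrow> continuous (at_right t) \<Lambda>"
    unfolding probabilistic_solution_def by blast+
  have le_\<alpha>: "\<Lambda> t \<le> \<alpha>" if "0 \<le> t" for t
  proof -
    have "\<Lambda> t = \<alpha> * prob {\<omega> \<in> space M. hitting_time B \<Lambda> \<omega> \<le> ereal t}"
      using sol that unfolding probabilistic_solution_def by blast
    also have "\<dots> \<le> \<alpha> * 1" using assms(1) by (intro mult_left_mono prob_le_1) auto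
    finally show ?thesis by simp
  qed
  \<comment> \<open>The height \<open>\<alpha> + 3\<close> makes room for \<open>{K..K + 1}\<close>
    within distance \<open>D1\<close> of \<open>L1\<close>.\<close>
  obtain \<eta> D1 where \<eta>: "0 < \<eta>" and D1: "\<alpha> + 3 \<le> D1"
    and p0: "0 < prob {\<omega> \<in> space M. B 0 \<omega> \<in> {\<Lambda> 0 + \<eta> + \<eta>..\<Lambda> 0 + \<eta> + D1}}"
    by (rule prob_start_in_interval_pos[OF prob_start_above_barrier_pos[OF sol assms(1) no_total_freezing_at_0]])
  define L1 where "L1 = \<Lambda> 0 + \<eta>"
  \<comment> \<open>Levels \<open>L2 < \<alpha> + 1\<close> will be used, so
    \<open>K \<ge> \<alpha> + 2\<close> leaves clearance one.\<close>
  define K where "K = L1 + \<alpha> + 2"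
  define s where "s = t0 - r\<^sup>2"
  have s: "0 < s" using assms(11) by (simp add: s_def)
  obtain e where e: "0 < e" "\<And>y. 0 \<le> y \<Longrightarrow> y < e \<Longrightarrow> \<Lambda> y < L1"
    using right_continuous_less[of 0 \<Lambda> L1] cont[of 0] \<eta> by (auto simp: L1_def)
  \<comment> \<open>Early enough that the barrier is still below \<open>L1\<close> and that the
    cylinder, which starts at time \<open>s\<close>, has not been reached.\<close>
  define \<epsilon> where "\<epsilon> = min e s / 2"
  have \<epsilon>: "0 < \<epsilon>" "\<epsilon> < s" "\<Lambda> \<epsilon> < L1" using e(1) s by (auto simp: \<epsilon>_def intro!: e(2))
  \<comment> \<open>As \<open>L2\<close> is positive, \<open>D\<close> bounds the distance from
    \<open>L2\<close> to both \<open>K + 1\<close> and any \<open>b < x0 + r + 1\<close>.\<close>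
  define D where "D = max (K + 1) (\<bar>x0\<bar> + r + 1)"
  define p where "p = kernel_const D1 \<epsilon> \<epsilon> * \<eta> * (K - L1) *
    prob {\<omega> \<in> space M. B 0 \<omega> \<in> {L1 + \<eta>..L1 + D1}}"
  \<comment> \<open>Throughout the cylinder the elapsed time \<open>t - \<epsilon>\<close> lies
    between \<open>s - \<epsilon>\<close> and \<open>t0 + r\<^sup>2\<close>, so the constant is
    uniform in \<open>x\<close> and \<open>t\<close>.\<close>
  define c where "c = kernel_const D (s - \<epsilon>) (t0 + r\<^sup>2) * p"
  have "0 < p"
    using p0 \<eta> \<epsilon> assms(1) kernel_const_pos[of \<epsilon> D1 \<epsilon>] by (simp add: p_def K_def L1_def)
  then have c: "0 < c"
    using kernel_const_pos[of "t0 + r\<^sup>2"] assms(8) by (simp add: c_def add_pos_nonneg)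
  have L1: "0 \<le> L1" using nonneg[of 0] \<eta> by (simp add: L1_def)
  have main: "c * (x - \<Lambda> t) \<le> u x t"
    if x: "\<Lambda> t < x" "x < x0 + r" and t: "s < t" "t < t0 + r\<^sup>2" for x t
  proof -
    have t_pos: "0 < t" using s t by simp
    \<comment> \<open>The survival bound needs a level strictly above \<open>\<Lambda> t\<close>;
      the cap \<open>\<Lambda> t + 1\<close> ensures \<open>L2 < \<alpha> + 1\<close>.\<close>
    have "c * (x - L2) \<le> u x t" if L2: "\<Lambda> t < L2" "L2 < min x (\<Lambda> t + 1)" for L2
    proof (rule associated_density_ge[OF assms(7) t_pos x(1), of 1])
      fix b assume b: "x < b" "b < x + 1"
      have "0 < L2" "L2 < \<alpha> + 1" using L2 nonneg[of t] le_\<alpha>[of t] t_pos by auto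
      have "kernel_const D (s - \<epsilon>) (t0 + r\<^sup>2) * (x - L2) * (b - x) * p
        \<le> prob {\<omega> \<in> space M. B t \<omega> \<in> {x..b} \<and> ereal t < hitting_time B \<Lambda> \<omega>}"
        unfolding p_def
      proof (rule survival_lower_bound[OF mono cont])
        have "K + 1 \<le> D" "\<bar>x0\<bar> + r + 1 \<le> D" by (simp_all add: D_def)
        then show "K + 1 \<le> L2 + D" "b \<le> L2 + D" using \<open>0 < L2\<close> b x by linarith+
        show "L1 < K" "K + 1 \<le> L1 + D1" "L2 + 1 \<le> K"
          using L1 D1 \<open>L2 < \<alpha> + 1\<close> assms(1) unfolding K_def by linarith+
        show "0 < s - \<epsilon>" "s - \<epsilon> \<le> t - \<epsilon>" "t - \<epsilon> \<le> t0 + r\<^sup>2" "\<epsilon> < t"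
          using \<epsilon> t by linarith+
      qed (use \<epsilon> \<eta> L2 b in auto)
      then show "c * (x - L2) * (b - x)
        \<le> prob {\<omega> \<in> space M. B t \<omega> \<in> {x..b} \<and> ereal t < hitting_time B \<Lambda> \<omega>}"
        by (simp add: c_def mult_ac)
    qed simp
    \<comment> \<open>Since \<open>c\<close> does not depend on \<open>L2\<close>, the level can now
      decrease to \<open>\<Lambda> t\<close>.\<close>
    then have "eventually (\<lambda>L2. c * (x - L2) \<le> u x t) (at_right (\<Lambda> t))"
      using x(1) by (auto simp: eventually_at_right_field intro!: exI[of _ "min x (\<Lambda> t + 1)"])
    moreover have "((\<lambda>L2. c * (x - L2)) \<longlongrightarrow> c * (x - \<Lambda> t)) (at_right (\<Lambda> t))"
      by (intro tendsto_intros)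
    ultimately show ?thesis by (intro tendsto_upperbound) auto
  qed
  have vanish: "u x t = 0" if "0 < t" "x \<le> \<Lambda> t" for x t
    using assms(7) that by (simp add: associated_density_def)
  have "c * max (x - \<Lambda> t) 0 \<le> u x t"
    if "x < x0 + r" "s < t" "t < t0 + r\<^sup>2" for x t
    using main[of t x] vanish[of t x] that s by (cases "\<Lambda> t < x") (auto simp: max_def)
  then show ?thesis
    using c by (intro exI[of _ c]) (auto simp: parabolic_cylinder_def s_def)
qed

end
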